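(* For every $d\in\mathbb N$, with $D_d=\{x\in\mathbb R^d:\sum_j|x_j|\le1\}$, $$\mathcal W^{\max}(D_d)\subseteq\mathcal W^{\min}([-1,1]^d).$$ Hence for every matrix convex set $\mathcal S\subseteq\bigcup_n(M_n)^d_{sa}$ we have $$[-1,1]^d\subseteq\mathcal S_1\ \Longrightarrow\ \mathcal W^{\max}(D_d)\subseteq\mathcal S.$$
   Context: $(M_n)^d_{sa}$ is the set of $d$-tuples of self-adjoint $n\times n$ complex matrices. A set $\mathcal S=\bigcup_n\mathcal S_n$ with $\mathcal S_n\subseteq(M_n)^d_{sa}$ is matrix convex if it is closed under direct sums and under unital completely positive maps (if $X\in\mathcal S_n$ and $\phi:M_n\to M_k$ is UCP then $(\phi(X_1),\dots,\phi(X_d))\in\mathcal S_k$); $\mathcal S_1\subseteq\mathbb R^d$. For a closed convex $K\subseteq\mathbb R^d$: $\mathcal W^{\min}(K)=\bigcup_n\mathcal W^{\min}_n(K)$, where $\mathcal W^{\min}_n(K)$ is the set of $X\in(M_n)^d_{sa}$ for which there are a tuple $N$ of commuting normal operators on a Hilbert space $L$ with joint spectrum $\sigma(N)\subseteq K$ and an isometry $V:\mathbb C^n\to L$ with $X_i=V^*N_iV$ for all $i$; and $\mathcal W^{\max}(K)=\bigcup_n\mathcal W^{\max}_n(K)$, where $\mathcal W^{\max}_n(K)$ is the set of $X\in(M_n)^d_{sa}$ such that $\sum_i\alpha_iX_i\le aI_n$ whenever $\alpha\in\mathbb R^d$, $a\in\mathbb R$ satisfy $\sum_i\alpha_ix_i\le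 a$ for all $x\in K$. Inclusion means inclusion at every level $n$. *)

theory Defs
  imports
    "HOL-Analysis.Finite_Cartesian_Product"
    "HOL-Library.FuncSet"
    "Jordan_Normal_Form.VS_Connect"
    "Jordan_Normal_Form.Schur_Decomposition"
begin

text \<open>
  Points of \<open>R^d\<close> are of type \<open>real ^ 'd\<close> (so \<open>d = CARD('d) \<ge> 1\<close>), and \<open>d\<close>-tuples of matrices
  of type \<open>complex mat ^ 'd\<close>. The level \<open>n\<close> is a natural number \<open>n \<ge> 1\<close>, and a graded set
  \<open>S = (\<Union>n. S_n)\<close> is the family \<open>S :: nat \<Rightarrow> (complex mat ^ 'd) set\<close> of its levels;
  the value at \<open>0\<close> is irrelevant.
  Both imported vector types use the infix dollar sign, so \<open>vec_nth\<close> is written out.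
\<close>

type_synonym 'd mat_tuple = "complex mat ^ 'd"

definition sa_tuples :: "nat \<Rightarrow> ('d::finite) mat_tuple set" where
  "sa_tuples n = {X. \<forall>i. vec_nth X i \<in> carrier_mat n n \<and> mat_adjoint (vec_nth X i) = vec_nth X i}"

text \<open>The order on \<open>complex\<close> makes \<open>0 \<le> z\<close> say that \<open>z\<close> is real and nonnegative, so
  self-adjointness is included in the following definition.\<close>

definition psd :: "nat \<Rightarrow> complex mat \<Rightarrow> bool" where
  "psd n A \<longleftrightarrow> A \<in> carrier_mat n n \<and> (\<forall>v \<in> carrier_vec n. 0 \<le> (A *\<^sub>v v) \<bullet>c v)"

definition loewner_le :: "nat \<Rightarrow> complex mat \<Rightarrow> complex mat \<Rightarrow> bool" where
  "loewner_le n A B \<longleftrightarrow> A \<in> carrier_mat n n \<and> B \<in> carrier_mat n n \<and> psd n (B - A)"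


subsection \<open>Matrix convex sets\<close>

definition direct_sum_mat :: "complex mat \<Rightarrow> complex mat \<Rightarrow> complex mat" where
  "direct_sum_mat A B =
     four_block_mat A (0\<^sub>m (dim_row A) (dim_col B)) (0\<^sub>m (dim_row B) (dim_col A)) B"

definition linear_mat_map :: "nat \<Rightarrow> nat \<Rightarrow> (complex mat \<Rightarrow> complex mat) \<Rightarrow> bool" where
  "linear_mat_map n k \<phi> \<longleftrightarrow>
     (\<forall>A \<in> carrier_mat n n. \<phi> A \<in> carrier_mat k k) \<and>
     (\<forall>A \<in> carrier_mat n n. \<forall>B \<in> carrier_mat n n. \<phi> (A + B) = \<phi> A + \<phi> B) \<and>
     (\<forall>c. \<forall>A \<in> carrier_mat n n. \<phi> (c \<cdot>\<^sub>m A) = c \<cdot>\<^sub>m \<phi> A)"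

text \<open>The element of \<open>M_p(M_n) = M_{pn}\<close> with the \<open>n \<times> n\<close> blocks \<open>A i j\<close>, \<open>i, j < p\<close>.\<close>

definition block_matrix :: "nat \<Rightarrow> nat \<Rightarrow> (nat \<Rightarrow> nat \<Rightarrow> complex mat) \<Rightarrow> complex mat" where
  "block_matrix p n A =
     mat (p * n) (p * n) (\<lambda>(r, s). A (r div n) (s div n) $$ (r mod n, s mod n))"

definition completely_positive :: "nat \<Rightarrow> nat \<Rightarrow> (complex mat \<Rightarrow> complex mat) \<Rightarrow> bool" where
  "completely_positive n k \<phi> \<longleftrightarrow>
     linear_mat_map n k \<phi> \<and>
     (\<forall>p A. (\<forall>i<p. \<forall>j<p. A i j \<in> carrier_mat n n) \<longrightarrow>
        psd (p * n) (block_matrix p n A) \<longrightarrow>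
        psd (p * k) (block_matrix p k (\<lambda>i j. \<phi> (A i j))))"

definition ucp :: "nat \<Rightarrow> nat \<Rightarrow> (complex mat \<Rightarrow> complex mat) \<Rightarrow> bool" where
  "ucp n k \<phi> \<longleftrightarrow> completely_positive n k \<phi> \<and> \<phi> (1\<^sub>m n) = 1\<^sub>m k"

definition matrix_convex :: "(nat \<Rightarrow> ('d::finite) mat_tuple set) \<Rightarrow> bool" where
  "matrix_convex S \<longleftrightarrow>
     (\<forall>n\<ge>1. S n \<subseteq> sa_tuples n) \<and>
     (\<forall>n\<ge>1. \<forall>m\<ge>1. \<forall>X \<in> S n. \<forall>Y \<in> S m.
        (\<chi> i. direct_sum_mat (vec_nth X i) (vec_nth Y i)) \<in> S (n + m)) \<and>
     (\<forall>n\<ge>1. \<forall>k\<ge>1. \<forall>X \<in> S n. \<forall>\<phi>. ucp n k \<phi> \<longrightarrow> (\<chi> i. \<phi> (vec_nth X i)) \<in> S k)"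

text \<open>The identification of a point of \<open>R^d\<close> with a tuple of \<open>1 \<times> 1\<close> matrices.\<close>

definition scalar_tuple :: "real ^ 'd \<Rightarrow> ('d::finite) mat_tuple" where
  "scalar_tuple x = (\<chi> i. mat 1 1 (\<lambda>_. complex_of_real (vec_nth x i)))"


subsection \<open>The maximal matrix convex set\<close>

definition real_lincomb :: "nat \<Rightarrow> real ^ 'd \<Rightarrow> ('d::finite) mat_tuple \<Rightarrow> complex mat" where
  "real_lincomb n \<alpha> X =
     mat n n (\<lambda>rs. \<Sum>i\<in>UNIV. complex_of_real (vec_nth \<alpha> i) * (vec_nth X i $$ rs))"

definition Wmax :: "(real ^ 'd) set \<Rightarrow> nat \<Rightarrow> ('d::finite) mat_tuple set" where
  "Wmax K n = {X \<in> sa_tuples n. \<forall>\<alpha> a.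
     (\<forall>x\<in>K. (\<Sum>i\<in>UNIV. vec_nth \<alpha> i * vec_nth x i) \<le> a) \<longrightarrow>
     loewner_le n (real_lincomb n \<alpha> X) (complex_of_real a \<cdot>\<^sub>m 1\<^sub>m n)}"


subsection \<open>Hilbert spaces and bounded operators\<close>

text \<open>A complex inner product space is a module record over \<open>complex\<close> (its ring multiplication
  and unit fields play no role) with an inner product, linear in the first argument.\<close>

record 'h inner_space = "(complex, 'h) module" +
  ip :: "'h \<Rightarrow> 'h \<Rightarrow> complex"

definition hnorm :: "('h, 'm) inner_space_scheme \<Rightarrow> 'h \<Rightarrow> real" where
  "hnorm H x = sqrt (Re (ip H x x))"

locale hilbert_space = vectorspace class_ring H
  for H :: "('h, 'm) inner_space_scheme" (structure) +
  assumes ip_add: "\<lbrakk>x \<in> carrier H; y \<in> carrier H; z \<in> carrier H\<rbrakk>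
      \<Longrightarrow> ip H (x \<oplus> y) z = ip H x z + ip H y z"
    and ip_smult: "\<lbrakk>x \<in> carrier H; y \<in> carrier H\<rbrakk> \<Longrightarrow> ip H (c \<odot> x) y = c * ip H x y"
    and ip_cnj: "\<lbrakk>x \<in> carrier H; y \<in> carrier H\<rbrakk> \<Longrightarrow> ip H y x = cnj (ip H x y)"
    and ip_nonneg: "x \<in> carrier H \<Longrightarrow> 0 \<le> ip H x x"
    and ip_definite: "\<lbrakk>x \<in> carrier H; ip H x x = 0\<rbrakk> \<Longrightarrow> x = \<zero>"
    and complete: "\<lbrakk>\<And>k. s k \<in> carrier H;
        \<And>e. e > 0 \<Longrightarrow> \<exists>M. \<forall>i\<ge>M. \<forall>j\<ge>M. hnorm H (s i \<ominus> s j) < e\<rbrakk>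
      \<Longrightarrow> \<exists>l \<in> carrier H. (\<lambda>k::nat. hnorm H (s k \<ominus> l)) \<longlonglongrightarrow> 0"

text \<open>The Hilbert space \<open>C^n\<close>.\<close>

definition Cn :: "nat \<Rightarrow> complex vec inner_space" where
  "Cn n = module.extend (module_vec TYPE(complex) n) \<lparr>ip = (\<lambda>u v. u \<bullet>c v)\<rparr>"

text \<open>Operators are extensional, that is, \<open>undefined\<close> outside the carrier of their domain, so that
  equality of operators is equality of functions.\<close>

definition bounded_ops ::
  "('h, 'm) inner_space_scheme \<Rightarrow> ('k, 'l) inner_space_scheme \<Rightarrow> ('h \<Rightarrow> 'k) set" where
  "bounded_ops H K = {T \<in> module_hom class_ring H K. T \<in> extensional (carrier H) \<and>
     (\<exists>C. \<forall>x \<in> carrier H. hnorm K (T x) \<le> C * hnorm H x)}"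

definition adj ::
  "('h, 'm) inner_space_scheme \<Rightarrow> ('k, 'l) inner_space_scheme \<Rightarrow> ('h \<Rightarrow> 'k) \<Rightarrow> 'k \<Rightarrow> 'h" where
  "adj H K T = (THE S. S \<in> bounded_ops K H \<and>
     (\<forall>x \<in> carrier H. \<forall>y \<in> carrier K. ip K (T x) y = ip H x (S y)))"

definition isometry ::
  "('h, 'm) inner_space_scheme \<Rightarrow> ('k, 'l) inner_space_scheme \<Rightarrow> ('h \<Rightarrow> 'k) \<Rightarrow> bool" where
  "isometry H K V \<longleftrightarrow> V \<in> bounded_ops H K \<and> (\<forall>x \<in> carrier H. hnorm K (V x) = hnorm H x)"

definition op_id :: "('h, 'm) inner_space_scheme \<Rightarrow> 'h \<Rightarrow> 'h" where
  "op_id H = (\<lambda>x \<in> carrier H. x)"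

definition op_add :: "('h, 'm) inner_space_scheme \<Rightarrow> ('h \<Rightarrow> 'h) \<Rightarrow> ('h \<Rightarrow> 'h) \<Rightarrow> 'h \<Rightarrow> 'h" where
  "op_add H S T = (\<lambda>x \<in> carrier H. S x \<oplus>\<^bsub>H\<^esub> T x)"

definition op_smult :: "('h, 'm) inner_space_scheme \<Rightarrow> complex \<Rightarrow> ('h \<Rightarrow> 'h) \<Rightarrow> 'h \<Rightarrow> 'h" where
  "op_smult H c T = (\<lambda>x \<in> carrier H. c \<odot>\<^bsub>H\<^esub> T x)"

definition op_mult :: "('h, 'm) inner_space_scheme \<Rightarrow> ('h \<Rightarrow> 'h) \<Rightarrow> ('h \<Rightarrow> 'h) \<Rightarrow> 'h \<Rightarrow> 'h" where
  "op_mult H S T = compose (carrier H) S T"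

definition op_converges ::
  "('h, 'm) inner_space_scheme \<Rightarrow> (nat \<Rightarrow> 'h \<Rightarrow> 'h) \<Rightarrow> ('h \<Rightarrow> 'h) \<Rightarrow> bool" where
  "op_converges H A T \<longleftrightarrow>
     (\<forall>e>0. \<exists>M. \<forall>k\<ge>M. \<forall>x \<in> carrier H. hnorm H (A k x \<ominus>\<^bsub>H\<^esub> T x) \<le> e * hnorm H x)"

definition normal_op :: "('h, 'm) inner_space_scheme \<Rightarrow> ('h \<Rightarrow> 'h) \<Rightarrow> bool" where
  "normal_op H T \<longleftrightarrow> T \<in> bounded_ops H H \<and> op_mult H T (adj H H T) = op_mult H (adj H H T) T"

definition commuting_normal_tuple ::
  "('h, 'm) inner_space_scheme \<Rightarrow> ('h \<Rightarrow> 'h) ^ ('d::finite) \<Rightarrow> bool" where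
  "commuting_normal_tuple H N \<longleftrightarrow>
     (\<forall>i. normal_op H (vec_nth N i)) \<and>
     (\<forall>i j. op_mult H (vec_nth N i) (vec_nth N j) = op_mult H (vec_nth N j) (vec_nth N i))"


subsection \<open>The joint spectrum\<close>

definition cstar_algebra_on :: "('h, 'm) inner_space_scheme \<Rightarrow> ('h \<Rightarrow> 'h) set \<Rightarrow> bool" where
  "cstar_algebra_on H A \<longleftrightarrow>
     A \<subseteq> bounded_ops H H \<and> op_id H \<in> A \<and>
     (\<forall>S\<in>A. \<forall>T\<in>A. op_add H S T \<in> A \<and> op_mult H S T \<in> A) \<and>
     (\<forall>c. \<forall>T\<in>A. op_smult H c T \<in> A) \<and>
     (\<forall>T\<in>A. adj H H T \<in> A) \<and>
     (\<forall>s. \<forall>T \<in> bounded_ops H H. (\<forall>k. s k \<in> A) \<longrightarrow> op_converges H s T \<longrightarrow> T \<in> A)"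

definition cstar_generated ::
  "('h, 'm) inner_space_scheme \<Rightarrow> ('h \<Rightarrow> 'h) set \<Rightarrow> ('h \<Rightarrow> 'h) set" where
  "cstar_generated H G = \<Inter>{A. cstar_algebra_on H A \<and> G \<subseteq> A}"

definition character_on ::
  "('h, 'm) inner_space_scheme \<Rightarrow> ('h \<Rightarrow> 'h) set \<Rightarrow> (('h \<Rightarrow> 'h) \<Rightarrow> complex) \<Rightarrow> bool" where
  "character_on H A f \<longleftrightarrow>
     (\<forall>S\<in>A. \<forall>T\<in>A. f (op_add H S T) = f S + f T) \<and>
     (\<forall>c. \<forall>T\<in>A. f (op_smult H c T) = c * f T) \<and>
     (\<forall>S\<in>A. \<forall>T\<in>A. f (op_mult H S T) = f S * f T) \<and>
     f (op_id H) = 1"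

text \<open>The joint spectrum of a commuting normal tuple \<open>N\<close>: the values at \<open>N\<close> of the characters
  of the commutative unital C*-algebra generated by \<open>N\<close>.\<close>

definition joint_spectrum ::
  "('h, 'm) inner_space_scheme \<Rightarrow> ('h \<Rightarrow> 'h) ^ 'd \<Rightarrow> (complex ^ ('d::finite)) set" where
  "joint_spectrum H N =
     {\<chi> i. f (vec_nth N i) | f. character_on H (cstar_generated H (range (vec_nth N))) f}"


subsection \<open>The minimal matrix convex set\<close>

text \<open>HOL cannot quantify existentially over types, so the Hilbert space \<open>L\<close> ranges over the Hilbert
  spaces whose carrier is a subset of the type \<open>nat \<Rightarrow> complex\<close>, with arbitrary operations and inner
  product. Up to unitary equivalence these are all separable Hilbert spaces. This loses nothing:
  for a dilation of \<open>X\<close> on any \<open>L\<close>, the closed subspace generated by the range of \<open>V\<close>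
  under the C*-algebra of \<open>N\<close> is separable and reduces \<open>N\<close>, and restricting \<open>N\<close> to it cannot
  enlarge the joint spectrum.\<close>

definition Wmin :: "(real ^ 'd) set \<Rightarrow> nat \<Rightarrow> ('d::finite) mat_tuple set" where
  "Wmin K n = {X \<in> sa_tuples n.
     \<exists>(L :: (nat \<Rightarrow> complex) inner_space) N V.
       hilbert_space L \<and> commuting_normal_tuple L N \<and>
       joint_spectrum L N \<subseteq> (\<lambda>x. \<chi> i. complex_of_real (vec_nth x i)) ` K \<and>
       isometry (Cn n) L V \<and>
       (\<forall>i. \<forall>u \<in> carrier_vec n. vec_nth X i *\<^sub>v u = adj (Cn n) L V (vec_nth N i (V u)))}"


definition cross_polytope :: "(real ^ ('d::finite)) set" where
  "cross_polytope = {x. (\<Sum>j\<in>UNIV. \<bar>vec_nth x j\<bar>) \<le> 1}"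

definition unit_cube :: "(real ^ ('d::finite)) set" where
  "unit_cube = {x. \<forall>j. vec_nth x j \<in> {-1..1}}"

end

theory Submission
  imports Defs
begin

text \<open>
  Let \<open>E = {-1, 1}\<^sup>d\<close>. If \<open>X\<close> is in \<open>Wmax(D\<^sub>d)\<close>, then \<open>- \<Sum> \<epsilon>\<^sub>i X\<^sub>i \<le> I\<close> for every \<open>\<epsilon> \<in> E\<close>, so the matrices
  \<open>H\<^sub>\<epsilon> = |E|\<^sup>-\<^sup>1 (I + \<Sum> \<epsilon>\<^sub>i X\<^sub>i)\<close> are positive. Orthogonality of the coordinate functions on \<open>E\<close> gives
  \<open>\<Sum> H\<^sub>\<epsilon> = I\<close> and \<open>\<Sum> \<epsilon>\<^sub>i H\<^sub>\<epsilon> = X\<^sub>i\<close>. Factoring each \<open>H\<^sub>\<epsilon>\<close> as \<open>B\<^sub>\<epsilon>\<^sup>* B\<^sub>\<epsilon>\<close> and stacking the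
  \<open>B\<^sub>\<epsilon>\<close> into an isometry \<open>W\<close>, we get \<open>X\<^sub>i = W\<^sup>* D\<^sub>i W\<close> with diagonal matrices \<open>D\<^sub>i\<close> whose entries are
  \<open>\<plusminus>1\<close>. The \<open>D\<^sub>i\<close> are a commuting normal dilation with joint spectrum in the cube, because a
  character takes the value \<open>\<plusminus>1\<close> at an operator with square \<open>1\<close>. Moreover, \<open>(D\<^sub>i)\<close> is a direct sum of
  vertices of the cube and \<open>A \<mapsto> W\<^sup>* A W\<close> is unital and completely positive.
\<close>


subsection \<open>Positive semidefinite forms\<close>

text \<open>Gaussian elimination: each induction step removes one index \<open>a\<close>, and its
  row becomes one row of the factor \<open>b\<close>, as in a Cholesky decomposition. An arbitrary
  finite index set keeps the induction free of renumbering. The order on complex numbers makes the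
  hypothesis contain hermitian symmetry.\<close>

lemma psd_form_factor:
  fixes h :: "'a \<Rightarrow> 'a \<Rightarrow> complex"
  assumes "finite I" "\<And>v. 0 \<le> (\<Sum>r\<in>I. \<Sum>s\<in>I. h r s * v s * cnj (v r))"
  shows "\<exists>b. \<forall>r\<in>I. \<forall>s\<in>I. h r s = (\<Sum>t\<in>I. cnj (b t r) * b t s)"
  using assms
proof (induction I arbitrary: h rule: finite_induct)
  case empty
  then show ?case by simp
next
  case (insert a I)
  note fin = insert.hyps(1) and a = insert.hyps(2)
  define Q where "Q v = (\<Sum>r\<in>insert a I. \<Sum>s\<in>insert a I. h r s * v s * cnj (v r))" for v
  have Q0: "0 \<le> Q v" for v
    using insert.prems unfolding Q_def .
  have Q_eq: "Q v = h a a * v a * cnj (v a) + (\<Sum>s\<in>I. h a s * v s) * cnj (v a)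
      + v a * (\<Sum>r\<in>I. h r a * cnj (v r)) + (\<Sum>r\<in>I. \<Sum>s\<in>I. h r s * v s * cnj (v r))" for v
    unfolding Q_def using fin a
    by (simp add: sum.distrib sum_distrib_left sum_distrib_right algebra_simps)
  \<comment> \<open>On vectors supported on \<open>a\<close> and \<open>s\<close> the form is that
    of a 2 by 2 principal submatrix; every fact about row \<open>a\<close> is read off from
    it.\<close>
  have two: "Q (\<lambda>r. if r = a then x else if r = s then y else 0) =
      h a a * x * cnj x + h a s * y * cnj x + x * (h s a * cnj y) + h s s * y * cnj y"
    if "s \<in> I" for s x y
  proof -
    have *: "(\<Sum>r\<in>I. g r * (if r = a then x else if r = s then y else 0)) = g s * y" 
      for g :: "'a \<Rightarrow> complex"
      using fin \<open>s \<in> I\<close> a by (subst sum.mono_neutral_right[of I "{s}"]) auto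
    have **: "(\<Sum>r\<in>I. g r * cnj (if r = a then x else if r = s then y else 0)) = g s * cnj y" 
      for g :: "'a \<Rightarrow> complex"
      using fin \<open>s \<in> I\<close> a by (subst sum.mono_neutral_right[of I "{s}"]) auto
    show ?thesis
      unfolding Q_eq * ** sum_distrib_right[symmetric] by simp
  qed
  have re: "Im (h r r) = 0" "0 \<le> Re (h r r)" if "r \<in> insert a I" for r
  proof -
    have "Q (\<lambda>s. if s = r then 1 else 0) = h r r"
      unfolding Q_def using fin that
      by (subst sum.mono_neutral_right[of "insert a I" "{r}"];
          simp; subst sum.mono_neutral_right[of "insert a I" "{r}"]; auto)
    then have "0 \<le> h r r" using Q0 by metis
    then show "Im (h r r) = 0" "0 \<le> Re (h r r)" by (auto simp: less_eq_complex_def)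
  qed
  \<comment> \<open>Polarization: the vectors \<open>(1, 1)\<close> and \<open>(1, \<i>)\<close>
    have real form values, which fixes the imaginary and the real part of
    \<open>h s a\<close>.\<close>
  have herm: "h s a = cnj (h a s)" if s: "s \<in> I" for s
  proof -
    have i1: "Im (Q (\<lambda>r. if r = a then 1 else if r = s then 1 else 0)) = 0"
      and i2: "Im (Q (\<lambda>r. if r = a then 1 else if r = s then \<i> else 0)) = 0"
      using Q0 by (auto simp: less_eq_complex_def)
    show ?thesis
      using i1 i2 re[of a] re[of s] s unfolding two[OF s] by (auto simp: complex_eq_iff)
  qed
  show ?case
  proof (cases "h a a = 0")
    case True
    \<comment> \<open>A zero pivot forces a zero row. With no quadratic term in \<open>x\<close>,
      the mixed term can be made as negative as desired; \<open>T\<close> is chosen so that the form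
      takes the value -1.\<close>
    have z: "h a s = 0" if s: "s \<in> I" for s
    proof (rule ccontr)
      assume nz: "h a s \<noteq> 0"
      define T where "T = (Re (h s s) + 1) / (2 * (cmod (h a s))\<^sup>2)"
      define x where "x = - (of_real T * h a s)"
      have "Re (Q (\<lambda>r. if r = a then x else if r = s then 1 else 0))
          = - 2 * T * (cmod (h a s))\<^sup>2 + Re (h s s)"
        unfolding two[OF s] True herm[OF s] x_def cmod_power2
        by (simp add: algebra_simps power2_eq_square)
      also have "\<dots> = -1" unfolding T_def using nz by (simp add: field_simps)
      finally show False using Q0[of "\<lambda>r. if r = a then x else if r = s then 1 else 0"]
        by (auto simp: less_eq_complex_def)
    qed
    have "\<exists>b. \<forall>r\<in>I. \<forall>s\<in>I. h r s = (\<Sum>t\<in>I. cnj (b t r) * b t s)"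
    proof (rule insert.IH)
      fix v
      have "Q (\<lambda>r. if r = a then 0 else v r) = (\<Sum>r\<in>I. \<Sum>s\<in>I. h r s * v s * cnj (v r))"
        unfolding Q_eq using a by (auto intro!: sum.cong)
      then show "0 \<le> (\<Sum>r\<in>I. \<Sum>s\<in>I. h r s * v s * cnj (v r))" using Q0 by metis
    qed
    then obtain b where b: "\<forall>r\<in>I. \<forall>s\<in>I. h r s = (\<Sum>t\<in>I. cnj (b t r) * b t s)" by blast
    \<comment> \<open>Row and column \<open>a\<close> of \<open>h\<close> vanish, so the factor for
      \<open>I\<close> is padded with zeros.\<close>
    define c where "c t r = (if t = a \<or> r = a then 0 else b t r)" for t r
    have "h r s = (\<Sum>t\<in>insert a I. cnj (c t r) * c t s)" if "r \<in> insert a I" "s \<in> insert a I" for r s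
    proof (cases "r = a \<or> s = a")
      case True
      then have "h r s = 0" using that z herm \<open>h a a = 0\<close> by auto
      moreover have "(\<Sum>t\<in>insert a I. cnj (c t r) * c t s) = 0" using True by (auto simp: c_def)
      ultimately show ?thesis by simp
    next
      case False
      then have "(\<Sum>t\<in>insert a I. cnj (c t r) * c t s) = (\<Sum>t\<in>I. cnj (b t r) * b t s)"
        using a fin by (auto simp: c_def intro!: sum.cong)
      then show ?thesis using b that False by auto
    qed
    then show ?thesis by blast
  next
    case False
    define p where "p = Re (h a a)"
    have p: "h a a = of_real p" "p > 0"
      using re[of a] False by (auto simp: p_def complex_eq_iff)
    \<comment> \<open>The square root of the pivot, by which the new row of the factor is
      scaled.\<close>
    define q where "q = complex_of_real (sqrt p)"
    have q: "q * q = of_real p" "cnj q = q" "q \<noteq> 0"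
      using p(2) unfolding q_def by (auto simp flip: of_real_mult)
    \<comment> \<open>The Schur complement of the entry \<open>h a a\<close>.\<close>
    define h' where "h' r s = h r s - cnj (h a r) * h a s / of_real p" for r s
    have "\<exists>b. \<forall>r\<in>I. \<forall>s\<in>I. h' r s = (\<Sum>t\<in>I. cnj (b t r) * b t s)"
    proof (rule insert.IH)
      fix v
      define y where "y = (\<Sum>s\<in>I. h a s * v s)"
      \<comment> \<open>Completing the square: this value at \<open>a\<close> minimizes the form for
        given \<open>v\<close> on \<open>I\<close>, and the minimum is the form of
        \<open>h'\<close>. Hence the Schur complement inherits positivity.\<close>
      define x where "x = - y / of_real p"
      let ?v = "\<lambda>r. if r = a then x else v r"
      have ne: "r \<noteq> a" if "r \<in> I" for r using that a by blast
      have e1: "(\<Sum>s\<in>I. h a s * ?v s) = y"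
        unfolding y_def using ne by (auto intro!: sum.cong)
      have e2: "(\<Sum>r\<in>I. h r a * cnj (?v r)) = cnj y"
        unfolding y_def cnj_sum using ne herm by (auto intro!: sum.cong)
      have e3: "(\<Sum>r\<in>I. \<Sum>s\<in>I. h r s * ?v s * cnj (?v r)) = (\<Sum>r\<in>I. \<Sum>s\<in>I. h r s * v s * cnj (v r))"
        using ne by (auto intro!: sum.cong)
      have e4: "(\<Sum>r\<in>I. \<Sum>s\<in>I. h' r s * v s * cnj (v r)) =
          (\<Sum>r\<in>I. \<Sum>s\<in>I. h r s * v s * cnj (v r)) - cnj y * y / of_real p"
        unfolding h'_def y_def
        by (simp add: sum_subtractf sum_distrib_left sum_distrib_right sum_divide_distrib algebra_simps)
      have "Q ?v = (\<Sum>r\<in>I. \<Sum>s\<in>I. h' r s * v s * cnj (v r))"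
        unfolding Q_eq e1 e2 e3 e4 unfolding p x_def using p(2) by (simp add: field_simps)
      then show "0 \<le> (\<Sum>r\<in>I. \<Sum>s\<in>I. h' r s * v s * cnj (v r))" using Q0 by metis
    qed
    then obtain b where b: "\<forall>r\<in>I. \<forall>s\<in>I. h' r s = (\<Sum>t\<in>I. cnj (b t r) * b t s)" by blast
    \<comment> \<open>Row \<open>a\<close> carries the rank one part that was subtracted in
      \<open>h'\<close>; the other rows come from the factor of \<open>h'\<close> and are zero in
      column \<open>a\<close>.\<close>
    define c where "c t r = (if t = a then h a r / q else if r = a then 0 else b t r)" for t r
    have "h r s = (\<Sum>t\<in>insert a I. cnj (c t r) * c t s)" if "r \<in> insert a I" "s \<in> insert a I" for r s
    proof -
      have "(\<Sum>t\<in>insert a I. cnj (c t r) * c t s) = cnj (h a r) * h a s / of_real p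
          + (\<Sum>t\<in>I. if r = a \<or> s = a then 0 else cnj (b t r) * b t s)"
      proof -
        have "(\<Sum>t\<in>I. cnj (c t r) * c t s) = (\<Sum>t\<in>I. if r = a \<or> s = a then 0 else cnj (b t r) * b t s)"
          using a by (intro sum.cong) (auto simp: c_def)
        moreover have "cnj (c a r) * c a s = cnj (h a r) * h a s / of_real p"
          by (simp add: c_def q)
        ultimately show ?thesis using a fin by simp
      qed
      moreover have "cnj (h a r) * h a s / of_real p = h r s" if "r = a \<or> s = a"
      proof (cases "r = a")
        case True
        then show ?thesis using p by simp
      next
        case False
        then have "s = a" "h r a = cnj (h a r)" using that herm \<open>r \<in> insert a I\<close> by blast+
        then show ?thesis using p by simp
      qed
      moreover have "(\<Sum>t\<in>I. cnj (b t r) * b t s) = h r s - cnj (h a r) * h a s / of_real p"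
        if "r \<noteq> a" "s \<noteq> a"
        using b that \<open>r \<in> insert a I\<close> \<open>s \<in> insert a I\<close> unfolding h'_def by auto
      ultimately show ?thesis by (cases "r = a \<or> s = a") auto
    qed
    then show ?thesis by blast
  qed
qed

text \<open>Test vectors become functions, of which only the values below \<open>n\<close> enter.
  This is the shape that \<open>psd_form_factor\<close> and the block computations work
  with.\<close>

lemma psd_iff:
  "psd n A \<longleftrightarrow> A \<in> carrier_mat n n \<and>
     (\<forall>v :: nat \<Rightarrow> complex. 0 \<le> (\<Sum>r<n. \<Sum>s<n. A $$ (r, s) * v s * cnj (v r)))"
proof -
  have form: "(A *\<^sub>v v) \<bullet>c v = (\<Sum>r<n. \<Sum>s<n. A $$ (r, s) * vec_index v s * cnj (vec_index v r))"
    if "A \<in> carrier_mat n n" "v \<in> carrier_vec n" for v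
    using that by (simp add: scalar_prod_def lessThan_atLeast0 sum_distrib_right)
  show ?thesis
  proof (cases "A \<in> carrier_mat n n")
    case True
    show ?thesis
    proof (intro iffI conjI allI)
      fix v :: "nat \<Rightarrow> complex"
      assume "psd n A"
      then have "0 \<le> (A *\<^sub>v vec n v) \<bullet>c vec n v" unfolding psd_def by simp
      then show "0 \<le> (\<Sum>r<n. \<Sum>s<n. A $$ (r, s) * v s * cnj (v r))"
        using form[OF True, of "vec n v"] by simp
    next
      assume *: "A \<in> carrier_mat n n \<and> (\<forall>v. 0 \<le> (\<Sum>r<n. \<Sum>s<n. A $$ (r, s) * v s * cnj (v r)))"
      show "psd n A" unfolding psd_def
      proof (intro conjI ballI True)
        fix v :: "complex vec" assume v: "v \<in> carrier_vec n"
        show "0 \<le> (A *\<^sub>v v) \<bullet>c v" unfolding form[OF True v]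
          using *[THEN conjunct2, THEN spec, of "vec_index v"] .
      qed
    qed (simp add: True)
  qed (auto simp: psd_def)
qed

subsection \<open>Averaging over sign vectors\<close>

definition sign_vectors :: "(real ^ 'd::finite) set" where
  "sign_vectors = {x. \<forall>i. vec_nth x i \<in> {-1, 1}}"

lemma finite_sign_vectors: "finite (sign_vectors :: (real ^ 'd::finite) set)"
proof -
  have "(sign_vectors :: (real ^ 'd) set) \<subseteq> (\<lambda>f. \<chi> i. f i) ` (UNIV \<rightarrow>\<^sub>E {-1, 1})"
  proof
    fix x :: "real ^ 'd" assume "x \<in> sign_vectors"
    then show "x \<in> (\<lambda>f. \<chi> i. f i) ` (UNIV \<rightarrow>\<^sub>E {-1, 1})"
      by (intro image_eqI[of _ _ "vec_nth x"]) (auto simp: sign_vectors_def)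
  qed
  then show ?thesis by (rule finite_subset) (intro finite_imageI finite_PiE; simp)
qed

text \<open>An involution of the sign vectors; reindexing along it yields both orthogonality
  relations below.\<close>

definition flip :: "'d \<Rightarrow> real ^ 'd \<Rightarrow> real ^ 'd::finite" where
  "flip i x = (\<chi> j. if j = i then - vec_nth x j else vec_nth x j)"

lemma bij_betw_flip: "bij_betw (flip i) sign_vectors sign_vectors"
proof (rule bij_betw_byWitness[where f' = "flip i"])
  show "flip i ` sign_vectors \<subseteq> sign_vectors" "flip i ` sign_vectors \<subseteq> sign_vectors"
    unfolding flip_def sign_vectors_def by force+
qed (simp_all add: flip_def Finite_Cartesian_Product.vec_eq_iff)

lemma sum_sign_vectors:
  "(\<Sum>\<epsilon>\<in>sign_vectors. vec_nth \<epsilon> i) = (0 :: real)"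
proof -
  have "(\<Sum>\<epsilon>\<in>sign_vectors. vec_nth \<epsilon> i) = (\<Sum>\<epsilon>\<in>sign_vectors. vec_nth (flip i \<epsilon>) i)"
    by (rule sum.reindex_bij_betw[OF bij_betw_flip, symmetric])
  then show ?thesis by (simp add: flip_def sum_negf)
qed

text \<open>Off the diagonal, flipping coordinate \<open>i\<close> alone negates the product, so the
  sum equals its own negative. On the diagonal every term is 1.\<close>

lemma sum_sign_vectors_mult:
  "(\<Sum>\<epsilon>\<in>sign_vectors. vec_nth \<epsilon> i * vec_nth \<epsilon> j) =
     (if i = j then real (card (sign_vectors :: (real ^ 'd) set)) else 0)"
  for i j :: "'d::finite"
proof (cases "i = j")
  case True
  have "(\<Sum>\<epsilon>\<in>sign_vectors. vec_nth \<epsilon> i * vec_nth \<epsilon> i) = (\<Sum>\<epsilon>\<in>(sign_vectors :: (real ^ 'd) set). 1)"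
    by (rule sum.cong) (auto simp: sign_vectors_def dest!: spec[of _ i])
  then show ?thesis using True by simp
next
  case False
  have "(\<Sum>\<epsilon>\<in>sign_vectors. vec_nth \<epsilon> i * vec_nth \<epsilon> j) =
      (\<Sum>\<epsilon>\<in>sign_vectors. vec_nth (flip i \<epsilon>) i * vec_nth (flip i \<epsilon>) j)"
    by (rule sum.reindex_bij_betw[OF bij_betw_flip, symmetric])
  then show ?thesis using False by (simp add: flip_def sum_negf)
qed

text \<open>The functional with coefficients \<open>- \<epsilon>\<close> is at most 1 on the
  cross-polytope, because all \<open>\<epsilon>\<close> entries have modulus 1. The matrix
  inequality that \<open>Wmax\<close> attaches to it is positivity of the identity plus the signed
  sum.\<close>

lemma Wmax_cross_polytope_sign_form:
  fixes X :: "('d::finite) mat_tuple"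
  assumes X: "X \<in> Wmax cross_polytope n" and e: "\<epsilon> \<in> sign_vectors"
  shows "0 \<le> (\<Sum>r<n. \<Sum>s<n. ((if r = s then 1 else 0)
      + (\<Sum>i\<in>UNIV. of_real (vec_nth \<epsilon> i) * vec_nth X i $$ (r, s))) * v s * cnj (v r))"
proof -
  have "(\<Sum>i\<in>UNIV. vec_nth (- \<epsilon>) i * vec_nth x i) \<le> 1" if "x \<in> cross_polytope" for x
  proof -
    have "vec_nth (- \<epsilon>) i * vec_nth x i \<le> \<bar>vec_nth x i\<bar>" for i
      using e[unfolded sign_vectors_def, simplified, THEN spec, of i] by auto
    then have "(\<Sum>i\<in>UNIV. vec_nth (- \<epsilon>) i * vec_nth x i) \<le> (\<Sum>i\<in>UNIV. \<bar>vec_nth x i\<bar>)"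
      by (intro sum_mono)
    then show ?thesis using that unfolding cross_polytope_def by simp
  qed
  then have "loewner_le n (real_lincomb n (- \<epsilon>) X) (complex_of_real 1 \<cdot>\<^sub>m 1\<^sub>m n)"
    using X unfolding Wmax_def by blast
  then have "psd n (complex_of_real 1 \<cdot>\<^sub>m 1\<^sub>m n - real_lincomb n (- \<epsilon>) X)"
    unfolding loewner_le_def by blast
  then have "0 \<le> (\<Sum>r<n. \<Sum>s<n. (complex_of_real 1 \<cdot>\<^sub>m 1\<^sub>m n - real_lincomb n (- \<epsilon>) X) $$ (r, s) * v s * cnj (v r))"
    unfolding psd_iff by blast
  also have "\<dots> = (\<Sum>r<n. \<Sum>s<n. ((if r = s then 1 else 0)
      + (\<Sum>i\<in>UNIV. of_real (vec_nth \<epsilon> i) * vec_nth X i $$ (r, s))) * v s * cnj (v r))"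
    by (intro sum.cong refl) (auto simp: real_lincomb_def sum_negf)
  finally show ?thesis .
qed

text \<open>\<open>X\<^sub>i = W\<^sup>* D\<^sub>i W\<close> for the isometry \<open>W : C\<^sup>n \<rightarrow> C\<^sup>m\<close> with matrix \<open>w\<close> and the diagonal matrices \<open>D\<^sub>i\<close>
  with entries \<open>\<sigma> k i \<in> {-1, 1}\<close>.\<close>

definition sign_compression :: "nat \<Rightarrow> nat \<Rightarrow> (nat \<Rightarrow> real ^ 'd) \<Rightarrow>
    (nat \<Rightarrow> nat \<Rightarrow> complex) \<Rightarrow> ('d::finite) mat_tuple \<Rightarrow> bool" where
  "sign_compression n m \<sigma> w X \<longleftrightarrow> range \<sigma> \<subseteq> sign_vectors \<and>
     (\<forall>r<n. \<forall>s<n. (\<Sum>k<m. cnj (w k r) * w k s) = (if r = s then 1 else 0)) \<and>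
     (\<forall>i. vec_nth X i = mat n n (\<lambda>(r, s). \<Sum>k<m. of_real (vec_nth (\<sigma> k) i) * cnj (w k r) * w k s))"

lemma Wmax_cross_polytope_sign_compression:
  fixes X :: "('d::finite) mat_tuple"
  assumes X: "X \<in> Wmax cross_polytope n" and n: "n \<ge> 1"
  obtains m \<sigma> w where "m \<ge> 1" "sign_compression n m \<sigma> w X"
proof -
  let ?E = "sign_vectors :: (real ^ 'd) set"
  define M where "M = card ?E"
  \<comment> \<open>The set of signs is nonempty, so the division by \<open>M\<close> in
    \<open>h\<close> is legitimate.\<close>
  have "(\<chi> i. 1) \<in> ?E" by (simp add: sign_vectors_def)
  then have M: "M > 0" unfolding M_def using finite_sign_vectors card_gt_0_iff by blast
  define h where "h \<epsilon> r s = ((if r = s then 1 else 0)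
      + (\<Sum>i\<in>UNIV. of_real (vec_nth \<epsilon> i) * vec_nth X i $$ (r, s))) / of_nat M" for \<epsilon> r s
  have "\<exists>b. \<forall>r\<in>{..<n}. \<forall>s\<in>{..<n}. h \<epsilon> r s = (\<Sum>t\<in>{..<n}. cnj (b t r) * b t s)" if "\<epsilon> \<in> ?E" for \<epsilon>
  proof (rule psd_form_factor)
    fix v :: "nat \<Rightarrow> complex"
    have "(\<Sum>r<n. \<Sum>s<n. h \<epsilon> r s * v s * cnj (v r)) = of_real (1 / real M) * (\<Sum>r<n. \<Sum>s<n. ((if r = s then 1 else 0)
      + (\<Sum>i\<in>UNIV. of_real (vec_nth \<epsilon> i) * vec_nth X i $$ (r, s))) * v s * cnj (v r))"
      unfolding h_def sum_distrib_left by (intro sum.cong refl) simp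
    then show "0 \<le> (\<Sum>r<n. \<Sum>s<n. h \<epsilon> r s * v s * cnj (v r))"
      using Wmax_cross_polytope_sign_form[OF X that, of v] M
      by (auto simp: less_eq_complex_def)
  qed simp
  then obtain b where b: "\<And>\<epsilon> r s. \<epsilon> \<in> ?E \<Longrightarrow> r < n \<Longrightarrow> s < n \<Longrightarrow> h \<epsilon> r s = (\<Sum>t<n. cnj (b \<epsilon> t r) * b \<epsilon> t s)"
    by (metis lessThan_iff)
  define m where "m = card (?E \<times> {..<n})"
  \<comment> \<open>Stacking the factors: a row index \<open>k\<close> of the isometry encodes a
    pair of a sign vector and a row of the factor belonging to it.\<close>
  obtain g where g: "bij_betw g {..<m} (?E \<times> {..<n})"
    using ex_bij_betw_nat_finite[of "?E \<times> {..<n}"] finite_sign_vectors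
    unfolding m_def atLeast0LessThan by blast
  \<comment> \<open>The default beyond \<open>m\<close> is a sign vector too, since
    \<open>sign_compression\<close> constrains the whole range of \<open>\<sigma>\<close>.\<close>
  define \<sigma> where "\<sigma> k = (if k < m then fst (g k) else (\<chi> i. 1))" for k
  define w where "w k = b (fst (g k)) (snd (g k))" for k
  have reidx: "(\<Sum>k<m. F (fst (g k)) (snd (g k))) = (\<Sum>\<epsilon>\<in>?E. \<Sum>t<n. F \<epsilon> t)" for F :: "_ \<Rightarrow> _ \<Rightarrow> complex"
    using sum.reindex_bij_betw[OF g, of "\<lambda>p. F (fst p) (snd p)"]
    by (simp add: sum.cartesian_product case_prod_beta)
  have card: "(\<Sum>\<epsilon>\<in>?E. 1 / of_nat M) = (1 :: complex)"
    using M by (simp add: M_def)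
  \<comment> \<open>Only the constant term of \<open>h\<close> survives summation over the signs;
    the linear terms vanish by \<open>sum_sign_vectors\<close>.\<close>
  have one: "(\<Sum>k<m. cnj (w k r) * w k s) = (if r = s then 1 else 0)" if "r < n" "s < n" for r s
  proof -
    have "(\<Sum>k<m. cnj (w k r) * w k s) = (\<Sum>\<epsilon>\<in>?E. h \<epsilon> r s)"
      unfolding w_def using that b by (subst reidx) simp
    also have "\<dots> = (\<Sum>\<epsilon>\<in>?E. (if r = s then 1 else 0) / of_nat M)
        + (\<Sum>\<epsilon>\<in>?E. \<Sum>i\<in>UNIV. of_real (vec_nth \<epsilon> i) * (vec_nth X i $$ (r, s) / of_nat M))"
      unfolding h_def by (simp add: add_divide_distrib sum.distrib sum_divide_distrib)
    also have "(\<Sum>\<epsilon>\<in>?E. \<Sum>i\<in>UNIV. of_real (vec_nth \<epsilon> i) * (vec_nth X i $$ (r, s) / of_nat M))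
        = (\<Sum>i\<in>UNIV. of_real (\<Sum>\<epsilon>\<in>?E. vec_nth \<epsilon> i) * (vec_nth X i $$ (r, s) / of_nat M))"
      by (subst sum.swap) (simp only: of_real_sum sum_distrib_right)
    also have "\<dots> = 0" by (simp only: sum_sign_vectors) simp
    also have "(\<Sum>\<epsilon>\<in>?E. (if r = s then 1 else 0) / of_nat M) = (if r = s then 1 else 0 :: complex)"
      using card by auto
    finally show ?thesis by simp
  qed
  \<comment> \<open>With the weight of coordinate \<open>i\<close> it is the constant term that
    vanishes, and orthogonality selects the linear term with \<open>j = i\<close>.\<close>
  have X_eq: "vec_nth X i $$ (r, s) = (\<Sum>k<m. of_real (vec_nth (\<sigma> k) i) * cnj (w k r) * w k s)"
    if "r < n" "s < n" for i r s
  proof -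
    have "(\<Sum>k<m. of_real (vec_nth (\<sigma> k) i) * cnj (w k r) * w k s)
        = (\<Sum>k<m. of_real (vec_nth (fst (g k)) i) * (cnj (w k r) * w k s))"
      unfolding \<sigma>_def by (intro sum.cong refl) auto
    also have "\<dots> = (\<Sum>\<epsilon>\<in>?E. of_real (vec_nth \<epsilon> i) * h \<epsilon> r s)"
      unfolding w_def
      using that b by (subst reidx[of "\<lambda>\<epsilon> t. of_real (vec_nth \<epsilon> i) * (cnj (b \<epsilon> t r) * b \<epsilon> t s)"])
        (simp add: sum_distrib_left)
    also have "\<dots> = (\<Sum>\<epsilon>\<in>?E. of_real (vec_nth \<epsilon> i)) * ((if r = s then 1 else 0) / of_nat M)
        + (\<Sum>\<epsilon>\<in>?E. \<Sum>j\<in>UNIV. of_real (vec_nth \<epsilon> i * vec_nth \<epsilon> j) * (vec_nth X j $$ (r, s) / of_nat M))"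
      unfolding h_def sum_distrib_right sum.distrib[symmetric]
      by (intro sum.cong refl) (simp add: add_divide_distrib sum_divide_distrib sum_distrib_left algebra_simps)
    also have "(\<Sum>\<epsilon>\<in>?E. complex_of_real (vec_nth \<epsilon> i)) = 0"
      using sum_sign_vectors[of i] by (simp flip: of_real_sum)
    also have "(\<Sum>\<epsilon>\<in>?E. \<Sum>j\<in>UNIV. of_real (vec_nth \<epsilon> i * vec_nth \<epsilon> j) * (vec_nth X j $$ (r, s) / of_nat M))
        = (\<Sum>j\<in>UNIV. of_real (\<Sum>\<epsilon>\<in>?E. vec_nth \<epsilon> i * vec_nth \<epsilon> j) * (vec_nth X j $$ (r, s) / of_nat M))"
      by (subst sum.swap) (simp only: of_real_sum sum_distrib_right)
    also have "\<dots> = (\<Sum>j\<in>UNIV. if i = j then vec_nth X j $$ (r, s) else 0)"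
      unfolding sum_sign_vectors_mult M_def[symmetric] using M by (intro sum.cong refl) simp
    also have "\<dots> = vec_nth X i $$ (r, s)" by simp
    finally show ?thesis by simp
  qed
  have carr: "vec_nth X i \<in> carrier_mat n n" for i
    using X unfolding Wmax_def sa_tuples_def by auto
  have "\<sigma> k \<in> ?E" for k
  proof (cases "k < m")
    case True
    then show ?thesis using bij_betwE[OF g] by (auto simp: \<sigma>_def mem_Times_iff)
  qed (simp add: \<sigma>_def sign_vectors_def)
  moreover have "vec_nth X i = mat n n (\<lambda>(r, s). \<Sum>k<m. of_real (vec_nth (\<sigma> k) i) * cnj (w k r) * w k s)" for i
    by (rule eq_matI) (simp_all add: X_eq carrier_matD[OF carr])
  ultimately have "sign_compression n m \<sigma> w X"
    unfolding sign_compression_def using one by blast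
  \<comment> \<open>Positive size matters later: matrix convexity is imposed only at levels from 1
    on.\<close>
  moreover have "m \<ge> 1"
    using M n unfolding m_def M_def card_cartesian_product by simp
  ultimately show ?thesis using that by blast
qed


subsection \<open>The finite-dimensional Hilbert space of the dilation\<close>

text \<open>A copy of m-dimensional complex space inside \<open>nat \<Rightarrow> complex\<close>,
  the type over which \<open>Wmin\<close> lets Hilbert spaces range. Vanishing from \<open>m\<close>
  on makes the first \<open>m\<close> coordinates determine the vector.\<close>

definition seq_space :: "nat \<Rightarrow> (nat \<Rightarrow> complex) inner_space" where
  "seq_space m = module.extend
     (module.make {f. \<forall>k\<ge>m. f k = 0} undefined undefined (\<lambda>_. 0) (\<lambda>f g k. f k + g k)
       (\<lambda>c f k. c * f k))
     \<lparr>ip = (\<lambda>f g. \<Sum>k<m. f k * cnj (g k))\<rparr>"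

lemma seq_space_simps:
  "carrier (seq_space m) = {f. \<forall>k\<ge>m. f k = 0}"
  "zero (seq_space m) = (\<lambda>_. 0)"
  "add (seq_space m) = (\<lambda>f g k. f k + g k)"
  "module.smult (seq_space m) = (\<lambda>c f k. c * f k)"
  "ip (seq_space m) = (\<lambda>f g. \<Sum>k<m. f k * cnj (g k))"
  by (simp_all add: seq_space_def module.extend_def module.make_def)

lemma Cn_simps:
  "carrier (Cn n) = carrier_vec n"
  "add (Cn n) = (+)"
  "module.smult (Cn n) = (\<cdot>\<^sub>v)"
  "ip (Cn n) = (\<lambda>u v. u \<bullet>c v)"
  by (simp_all add: Cn_def module.extend_def module_vec_def)

lemma ip_Cn:
  "u \<in> carrier_vec n \<Longrightarrow> v \<in> carrier_vec n \<Longrightarrow> ip (Cn n) u v = (\<Sum>k<n. vec_index u k * cnj (vec_index v k))"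
  by (simp add: Cn_simps scalar_prod_def lessThan_atLeast0)

lemma sum_mult_cnj: "(\<Sum>k\<in>A. f k * cnj (f k)) = of_real (\<Sum>k\<in>A. (cmod (f k))\<^sup>2)"
  unfolding of_real_sum by (intro sum.cong refl) (rule complex_norm_square[symmetric])

lemma hnorm_seq_space: "hnorm (seq_space m) f = L2_set (\<lambda>k. cmod (f k)) {..<m}"
  by (simp add: hnorm_def seq_space_simps sum_mult_cnj L2_set_def)

lemma hnorm_Cn: "u \<in> carrier_vec n \<Longrightarrow> hnorm (Cn n) u = L2_set (\<lambda>k. cmod (vec_index u k)) {..<n}"
  by (simp add: hnorm_def ip_Cn sum_mult_cnj L2_set_def)

lemma abelian_group_seq_space: "abelian_group (seq_space m)"
proof (rule abelian_groupI)
  fix x :: "nat \<Rightarrow> complex"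
  assume "x \<in> carrier (seq_space m)"
  then show "\<exists>y\<in>carrier (seq_space m). y \<oplus>\<^bsub>seq_space m\<^esub> x = \<zero>\<^bsub>seq_space m\<^esub>"
    by (intro bexI[of _ "\<lambda>k. - x k"]) (auto simp: seq_space_simps)
qed (auto simp: seq_space_simps algebra_simps)

lemma vectorspace_seq_space: "vectorspace class_ring (seq_space m)"
proof -
  have "Module.module class_ring (seq_space m)"
    by (rule moduleI[OF _ abelian_group_seq_space])
      (auto simp: seq_space_simps algebra_simps class_cring.is_cring)
  then show ?thesis
    unfolding vectorspace_def using class_field by (auto simp: class_field_def)
qed

lemma minus_seq_space:
  assumes "f \<in> carrier (seq_space m)" "g \<in> carrier (seq_space m)"
  shows "f \<ominus>\<^bsub>seq_space m\<^esub> g = (\<lambda>k. f k - g k)"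
proof -
  interpret abelian_group "seq_space m" by (rule abelian_group_seq_space)
  have "\<ominus>\<^bsub>seq_space m\<^esub> g = (\<lambda>k. - g k)"
    by (rule minus_equality) (use assms in \<open>auto simp: seq_space_simps\<close>)
  then show ?thesis by (simp add: a_minus_def seq_space_simps)
qed

lemma hilbert_space_seq_space: "hilbert_space (seq_space m)"
proof (rule hilbert_space.intro[OF vectorspace_seq_space], unfold_locales)
  fix x :: "nat \<Rightarrow> complex"
  assume "x \<in> carrier (seq_space m)"
  show "0 \<le> ip (seq_space m) x x"
    unfolding seq_space_simps sum_mult_cnj by (simp add: less_eq_complex_def sum_nonneg)
next
  fix x :: "nat \<Rightarrow> complex"
  assume x: "x \<in> carrier (seq_space m)" and "ip (seq_space m) x x = 0"
  then have "(\<Sum>k<m. (cmod (x k))\<^sup>2) = 0"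
    unfolding seq_space_simps sum_mult_cnj of_real_eq_0_iff by blast
  then have "x k = 0" if "k < m" for k
    using that by (simp add: sum_nonneg_eq_0_iff)
  then show "x = \<zero>\<^bsub>seq_space m\<^esub>"
    using x by (auto simp: seq_space_simps fun_eq_iff not_less[symmetric])
next
  fix s :: "nat \<Rightarrow> nat \<Rightarrow> complex"
  assume s: "\<And>k. s k \<in> carrier (seq_space m)"
    and cauchy: "\<And>e. e > 0 \<Longrightarrow> \<exists>M. \<forall>i\<ge>M. \<forall>j\<ge>M. hnorm (seq_space m) (s i \<ominus>\<^bsub>seq_space m\<^esub> s j) < e"
  \<comment> \<open>Completeness is checked coordinatewise: each coordinate is dominated by the
    norm, and the norm is a continuous function of finitely many coordinates.\<close>
  have "\<exists>l. (\<lambda>i. s i k) \<longlonglongrightarrow> l" if k: "k < m" for k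
  proof -
    have "cmod (s i k - s j k) \<le> hnorm (seq_space m) (s i \<ominus>\<^bsub>seq_space m\<^esub> s j)" for i j
      unfolding minus_seq_space[OF s s] hnorm_seq_space
      using k by (intro member_le_L2_set[of "{..<m}" k "\<lambda>k. cmod (s i k - s j k)"]) auto
    then have "Cauchy (\<lambda>i. s i k)"
      unfolding Cauchy_def dist_norm using cauchy by (meson le_less_trans)
    then show ?thesis using Cauchy_convergent_iff convergent_def by blast
  qed
  then obtain l where l: "\<And>k. k < m \<Longrightarrow> (\<lambda>i. s i k) \<longlonglongrightarrow> l k" by metis
  define l' where "l' k = (if k < m then l k else 0)" for k
  have l': "l' \<in> carrier (seq_space m)" by (simp add: l'_def seq_space_simps)
  have "(\<lambda>i. sqrt (\<Sum>k<m. (cmod (s i k - l' k))\<^sup>2)) \<longlonglongrightarrow> sqrt (\<Sum>k<m. (cmod (l' k - l' k))\<^sup>2)"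
    by (intro tendsto_intros) (use l in \<open>auto simp: l'_def\<close>)
  then have "(\<lambda>i. hnorm (seq_space m) (s i \<ominus>\<^bsub>seq_space m\<^esub> l')) \<longlonglongrightarrow> 0"
    unfolding minus_seq_space[OF s l'] hnorm_seq_space L2_set_def by simp
  with l' show "\<exists>l\<in>carrier (seq_space m). (\<lambda>i. hnorm (seq_space m) (s i \<ominus>\<^bsub>seq_space m\<^esub> l)) \<longlonglongrightarrow> 0"
    by blast
qed (auto simp: seq_space_simps sum_distrib_left sum.distrib algebra_simps intro!: sum.cong)

section \<open>Adjoints, multiplication operators and operators given by matrices\<close>

text \<open>\<open>adj\<close> is a definite description, so a candidate must also be shown unique:
  two candidates have equal inner products with every vector of \<open>H\<close>, and nondegeneracy
  identifies their values, while extensionality fixes them elsewhere.\<close>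

lemma adj_eqI:
  assumes S: "S \<in> bounded_ops K H"
    and adjoint: "\<And>x y. x \<in> carrier H \<Longrightarrow> y \<in> carrier K \<Longrightarrow> ip K (T x) y = ip H x (S y)"
    and nondeg: "\<And>y z. y \<in> carrier H \<Longrightarrow> z \<in> carrier H \<Longrightarrow>
        (\<And>x. x \<in> carrier H \<Longrightarrow> ip H x y = ip H x z) \<Longrightarrow> y = z"
  shows "adj H K T = S"
  unfolding adj_def
proof (rule the_equality)
  fix S' assume S': "S' \<in> bounded_ops K H \<and> (\<forall>x\<in>carrier H. \<forall>y\<in>carrier K. ip K (T x) y = ip H x (S' y))"
  show "S' = S"
  proof (rule extensionalityI[of _ "carrier K"])
    fix y assume y: "y \<in> carrier K"
    show "S' y = S y"
    proof (rule nondeg)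
      show "S' y \<in> carrier H" "S y \<in> carrier H"
        using S S' y by (auto simp: bounded_ops_def module_hom_def)
    qed (use S' y adjoint in metis)
  qed (use S S' in \<open>auto simp: bounded_ops_def\<close>)
qed (use S adjoint in auto)

lemma seq_space_nondegenerate:
  assumes "y \<in> carrier (seq_space m)" "z \<in> carrier (seq_space m)"
    and "\<And>x. x \<in> carrier (seq_space m) \<Longrightarrow> ip (seq_space m) x y = ip (seq_space m) x z"
  shows "y = z"
proof
  fix k
  show "y k = z k"
  proof (cases "k < m")
    case True
    have "cnj (y k) = cnj (z k)"
      using assms(3)[of "\<lambda>j. if j = k then 1 else 0"] True
      by (simp add: seq_space_simps if_distrib[of "\<lambda>x. x * _"] cong: if_cong)
    then show ?thesis by simp
  qed (use assms(1,2) in \<open>auto simp: seq_space_simps\<close>)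
qed

lemma Cn_nondegenerate:
  assumes "y \<in> carrier (Cn n)" "z \<in> carrier (Cn n)"
    and "\<And>x. x \<in> carrier (Cn n) \<Longrightarrow> ip (Cn n) x y = ip (Cn n) x z"
  shows "y = z"
proof (rule eq_vecI)
  fix k assume "k < dim_vec z"
  then have k: "k < n" using assms by (simp add: Cn_simps)
  have "cnj (vec_index y k) = cnj (vec_index z k)"
    using assms(3)[of "unit_vec n k"] assms(1,2) k
    by (simp add: Cn_simps)
  then show "vec_index y k = vec_index z k" by simp
qed (use assms in \<open>auto simp: Cn_simps\<close>)

text \<open>The diagonal operators of the dilation. This operator and the two below are restricted
  to their carriers because \<open>bounded_ops\<close> demands extensional functions.\<close>

definition mult_op :: "nat \<Rightarrow> (nat \<Rightarrow> real) \<Rightarrow> (nat \<Rightarrow> complex) \<Rightarrow> nat \<Rightarrow> complex" where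
  "mult_op m c = (\<lambda>f \<in> carrier (seq_space m). \<lambda>k. of_real (c k) * f k)"

definition mat_op :: "nat \<Rightarrow> nat \<Rightarrow> (nat \<Rightarrow> nat \<Rightarrow> complex) \<Rightarrow> complex vec \<Rightarrow> nat \<Rightarrow> complex" where
  "mat_op n m w = (\<lambda>u \<in> carrier (Cn n). \<lambda>k. if k < m then \<Sum>s<n. w k s * vec_index u s else 0)"

definition mat_op_adj :: "nat \<Rightarrow> nat \<Rightarrow> (nat \<Rightarrow> nat \<Rightarrow> complex) \<Rightarrow> (nat \<Rightarrow> complex) \<Rightarrow> complex vec" where
  "mat_op_adj n m w = (\<lambda>f \<in> carrier (seq_space m). vec n (\<lambda>s. \<Sum>k<m. cnj (w k s) * f k))"

lemma mult_op_closed: "f \<in> carrier (seq_space m) \<Longrightarrow> mult_op m c f \<in> carrier (seq_space m)"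
  by (simp add: mult_op_def seq_space_simps)

lemma mat_op_closed: "u \<in> carrier (Cn n) \<Longrightarrow> mat_op n m w u \<in> carrier (seq_space m)"
  by (simp add: mat_op_def seq_space_simps)

lemma mult_op_bounded:
  assumes "\<And>k. \<bar>c k\<bar> \<le> 1"
  shows "mult_op m c \<in> bounded_ops (seq_space m) (seq_space m)"
proof -
  have "hnorm (seq_space m) (mult_op m c f) \<le> 1 * hnorm (seq_space m) f" if "f \<in> carrier (seq_space m)" for f
    unfolding hnorm_seq_space mult_1 using that assms
    by (intro L2_set_mono) (auto simp: mult_op_def norm_mult mult_left_le_one_le)
  moreover have "mult_op m c \<in> module_hom class_ring (seq_space m) (seq_space m)"
    unfolding module_hom_def
    by (auto simp: mult_op_def seq_space_simps algebra_simps)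
  ultimately show ?thesis
    unfolding bounded_ops_def by (auto simp: mult_op_def intro!: exI[of _ 1])
qed

lemma adj_mult_op:
  assumes "\<And>k. \<bar>c k\<bar> \<le> 1"
  shows "adj (seq_space m) (seq_space m) (mult_op m c) = mult_op m c"
  using mult_op_bounded[OF assms]
proof (rule adj_eqI)
  show "ip (seq_space m) (mult_op m c x) y = ip (seq_space m) x (mult_op m c y)"
    if "x \<in> carrier (seq_space m)" "y \<in> carrier (seq_space m)" for x y
    using that by (simp add: mult_op_def) (simp add: seq_space_simps mult.assoc mult.left_commute)
qed (fact seq_space_nondegenerate)

lemma op_mult_mult_op:
  "op_mult (seq_space m) (mult_op m c) (mult_op m d) = mult_op m (\<lambda>k. c k * d k)"
  unfolding op_mult_def
  by (rule extensionalityI[of _ "carrier (seq_space m)"])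
    (auto simp: compose_def mult_op_def seq_space_simps)

lemma mat_op_module_hom: "mat_op n m w \<in> module_hom class_ring (Cn n) (seq_space m)"
  unfolding module_hom_def
proof (intro CollectI conjI allI impI)
  show "mat_op n m w \<in> carrier (Cn n) \<rightarrow> carrier (seq_space m)"
    using mat_op_closed by blast
  show "mat_op n m w (u \<oplus>\<^bsub>Cn n\<^esub> v) = mat_op n m w u \<oplus>\<^bsub>seq_space m\<^esub> mat_op n m w v"
    if "u \<in> carrier (Cn n) \<and> v \<in> carrier (Cn n)" for u v
  proof -
    have "u \<in> carrier_vec n" "v \<in> carrier_vec n" using that by (auto simp: Cn_simps)
    then show ?thesis
      by (auto simp: mat_op_def Cn_simps seq_space_simps fun_eq_iff sum.distrib algebra_simps)
  qed
  show "mat_op n m w (c \<odot>\<^bsub>Cn n\<^esub> v) = c \<odot>\<^bsub>seq_space m\<^esub> mat_op n m w v"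
    if "c \<in> carrier class_ring \<and> v \<in> carrier (Cn n)" for c v
  proof -
    have "v \<in> carrier_vec n" using that by (auto simp: Cn_simps)
    then show ?thesis
      by (auto simp: mat_op_def Cn_simps seq_space_simps fun_eq_iff sum_distrib_left algebra_simps)
  qed
qed

lemma mat_op_adj_module_hom: "mat_op_adj n m w \<in> module_hom class_ring (seq_space m) (Cn n)"
  unfolding module_hom_def
proof (intro CollectI conjI allI impI)
  show "mat_op_adj n m w \<in> carrier (seq_space m) \<rightarrow> carrier (Cn n)"
    by (auto simp: mat_op_adj_def Cn_simps)
  show "mat_op_adj n m w (f \<oplus>\<^bsub>seq_space m\<^esub> g) = mat_op_adj n m w f \<oplus>\<^bsub>Cn n\<^esub> mat_op_adj n m w g"
    if "f \<in> carrier (seq_space m) \<and> g \<in> carrier (seq_space m)" for f g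
    by (rule eq_vecI) (use that in \<open>auto simp: mat_op_adj_def Cn_simps seq_space_simps sum.distrib algebra_simps\<close>)
  show "mat_op_adj n m w (c \<odot>\<^bsub>seq_space m\<^esub> f) = c \<odot>\<^bsub>Cn n\<^esub> mat_op_adj n m w f"
    if "c \<in> carrier class_ring \<and> f \<in> carrier (seq_space m)" for c f
    by (rule eq_vecI) (use that in \<open>auto simp: mat_op_adj_def Cn_simps seq_space_simps sum_distrib_left algebra_simps\<close>)
qed

text \<open>A crude bound suffices: the Euclidean norm is at most the sum of the moduli, and each
  coordinate of \<open>f\<close> is at most its norm.\<close>

lemma mat_op_adj_bounded: "mat_op_adj n m w \<in> bounded_ops (seq_space m) (Cn n)"
proof -
  have "hnorm (Cn n) (mat_op_adj n m w f) \<le> (\<Sum>s<n. \<Sum>k<m. cmod (w k s)) * hnorm (seq_space m) f"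
    if f: "f \<in> carrier (seq_space m)" for f
  proof -
    have "hnorm (Cn n) (mat_op_adj n m w f) = L2_set (\<lambda>s. cmod (\<Sum>k<m. cnj (w k s) * f k)) {..<n}"
      using f by (subst hnorm_Cn) (auto simp: mat_op_adj_def intro!: L2_set_cong)
    also have "\<dots> \<le> (\<Sum>s<n. cmod (\<Sum>k<m. cnj (w k s) * f k))"
      by (rule L2_set_le_sum) simp
    also have "\<dots> \<le> (\<Sum>s<n. \<Sum>k<m. cmod (w k s) * hnorm (seq_space m) f)"
    proof (intro sum_mono)
      fix s
      have "cmod (\<Sum>k<m. cnj (w k s) * f k) \<le> (\<Sum>k<m. cmod (w k s) * cmod (f k))"
        by (rule order.trans[OF norm_sum]) (simp add: norm_mult)
      also have "\<dots> \<le> (\<Sum>k<m. cmod (w k s) * hnorm (seq_space m) f)"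
        unfolding hnorm_seq_space
        by (intro sum_mono mult_left_mono member_le_L2_set[of "{..<m}" _ "\<lambda>k. cmod (f k)"]) auto
      finally show "cmod (\<Sum>k<m. cnj (w k s) * f k) \<le> (\<Sum>k<m. cmod (w k s) * hnorm (seq_space m) f)" .
    qed
    finally show ?thesis by (simp add: sum_distrib_right)
  qed
  then show ?thesis
    unfolding bounded_ops_def using mat_op_adj_module_hom by (auto simp: mat_op_adj_def)
qed

lemma ip_mat_op:
  assumes u: "u \<in> carrier (Cn n)" and f: "f \<in> carrier (seq_space m)"
  shows "ip (seq_space m) (mat_op n m w u) f = ip (Cn n) u (mat_op_adj n m w f)"
proof -
  have "ip (seq_space m) (mat_op n m w u) f = (\<Sum>k<m. \<Sum>s<n. w k s * vec_index u s * cnj (f k))"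
    using u by (simp add: mat_op_def seq_space_simps sum_distrib_right)
  also have "\<dots> = (\<Sum>s<n. \<Sum>k<m. w k s * vec_index u s * cnj (f k))"
    by (rule sum.swap)
  also have "\<dots> = ip (Cn n) u (mat_op_adj n m w f)"
    using u f by (subst ip_Cn) (auto simp: mat_op_adj_def Cn_simps sum_distrib_left algebra_simps)
  finally show ?thesis .
qed

lemma adj_mat_op: "adj (Cn n) (seq_space m) (mat_op n m w) = mat_op_adj n m w"
  using mat_op_adj_bounded ip_mat_op Cn_nondegenerate by (rule adj_eqI)

text \<open>Identifies the compression of a diagonal operator with the matrix in
  \<open>sign_compression\<close>; with all \<open>c k = 1\<close> it also computes the Gram matrix
  of \<open>w\<close>.\<close>

lemma mat_op_adj_mult_op_mat_op:
  assumes u: "u \<in> carrier_vec n"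
  shows "mat_op_adj n m w (mult_op m c (mat_op n m w u)) =
    mat n n (\<lambda>(r, s). \<Sum>k<m. of_real (c k) * cnj (w k r) * w k s) *\<^sub>v u"
proof (rule eq_vecI)
  have V: "mat_op n m w u \<in> carrier (seq_space m)"
    using u by (intro mat_op_closed) (simp add: Cn_simps)
  note NV = mult_op_closed[OF V, of c]
  let ?X = "mat n n (\<lambda>(r, s). \<Sum>k<m. of_real (c k) * cnj (w k r) * w k s)"
  show "dim_vec (mat_op_adj n m w (mult_op m c (mat_op n m w u))) = dim_vec (?X *\<^sub>v u)"
    using NV by (simp add: mat_op_adj_def)
  fix r assume "r < dim_vec (?X *\<^sub>v u)"
  then have r: "r < n" by simp
  have "vec_index (?X *\<^sub>v u) r = (\<Sum>s<n. \<Sum>k<m. of_real (c k) * cnj (w k r) * w k s * vec_index u s)"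
    using u r by (simp add: scalar_prod_def lessThan_atLeast0 sum_distrib_right)
  also have "\<dots> = (\<Sum>k<m. \<Sum>s<n. of_real (c k) * cnj (w k r) * w k s * vec_index u s)"
    by (rule sum.swap)
  also have "\<dots> = (\<Sum>k<m. cnj (w k r) * mult_op m c (mat_op n m w u) k)"
    using V u by (intro sum.cong refl)
      (simp add: mult_op_def mat_op_def Cn_simps sum_distrib_left algebra_simps)
  also have "\<dots> = vec_index (mat_op_adj n m w (mult_op m c (mat_op n m w u))) r"
    using NV r by (simp add: mat_op_adj_def)
  finally show "vec_index (mat_op_adj n m w (mult_op m c (mat_op n m w u))) r = vec_index (?X *\<^sub>v u) r" ..
qed

lemma isometry_mat_op:
  assumes w: "\<And>r s. r < n \<Longrightarrow> s < n \<Longrightarrow> (\<Sum>k<m. cnj (w k r) * w k s) = (if r = s then 1 else 0)"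
  shows "isometry (Cn n) (seq_space m) (mat_op n m w)"
proof -
  have norm: "hnorm (seq_space m) (mat_op n m w u) = hnorm (Cn n) u" if u: "u \<in> carrier (Cn n)" for u
  proof -
    have V: "mat_op n m w u \<in> carrier (seq_space m)" using u by (rule mat_op_closed)
    \<comment> \<open>The case of the identity multiplier: the adjoint composed with the operator is
      the identity, which gives preservation of the norm.\<close>
    have "mat_op_adj n m w (mult_op m (\<lambda>_. 1) (mat_op n m w u)) =
        mat n n (\<lambda>(r, s). \<Sum>k<m. of_real 1 * cnj (w k r) * w k s) *\<^sub>v u"
      by (rule mat_op_adj_mult_op_mat_op) (use u in \<open>simp add: Cn_simps\<close>)
    also have "mat n n (\<lambda>(r, s). \<Sum>k<m. of_real 1 * cnj (w k r) * w k s) = 1\<^sub>m n"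
      by (rule eq_matI) (auto simp: w)
    also have "mult_op m (\<lambda>_. 1) (mat_op n m w u) = mat_op n m w u"
      using V by (simp add: mult_op_def)
    finally have "mat_op_adj n m w (mat_op n m w u) = u" using u by (simp add: Cn_simps)
    then show ?thesis unfolding hnorm_def ip_mat_op[OF u V] by simp
  qed
  then have "mat_op n m w \<in> bounded_ops (Cn n) (seq_space m)"
    unfolding bounded_ops_def using mat_op_module_hom by (auto simp: mat_op_def intro!: exI[of _ 1])
  with norm show ?thesis unfolding isometry_def by blast
qed

section \<open>Characters and the normal dilation\<close>

lemma generator_in_cstar_generated: "G \<subseteq> cstar_generated H G"
  unfolding cstar_generated_def by blast

lemma op_id_in_cstar_generated: "op_id H \<in> cstar_generated H G"
  unfolding cstar_generated_def cstar_algebra_on_def by blast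

lemma sign_compression_in_Wmin:
  fixes X :: "('d::finite) mat_tuple"
  assumes X: "X \<in> sa_tuples n" and c: "sign_compression n m \<sigma> w X"
  shows "X \<in> Wmin unit_cube n"
proof -
  define N :: "((nat \<Rightarrow> complex) \<Rightarrow> nat \<Rightarrow> complex) ^ 'd"
    where "N = (\<chi> i. mult_op m (\<lambda>k. vec_nth (\<sigma> k) i))"
  have N: "vec_nth N i = mult_op m (\<lambda>k. vec_nth (\<sigma> k) i)" for i
    by (simp add: N_def)
  have sgn: "vec_nth (\<sigma> k) i = -1 \<or> vec_nth (\<sigma> k) i = 1" for k i
    using c unfolding sign_compression_def sign_vectors_def by blast
  then have bd: "\<bar>vec_nth (\<sigma> k) i\<bar> \<le> 1" for k i
    by (metis abs_1 abs_minus order_refl)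
  have sq: "vec_nth (\<sigma> k) i * vec_nth (\<sigma> k) i = 1" for k i
    using sgn[of k i] by auto
  \<comment> \<open>Real entries make each operator its own adjoint, so normality is immediate, and
    commutation is that of real multiplication.\<close>
  have "commuting_normal_tuple (seq_space m) N"
    unfolding commuting_normal_tuple_def normal_op_def N adj_mult_op[OF bd] op_mult_mult_op
    using mult_op_bounded[OF bd] by (simp add: mult.commute)
  moreover have "joint_spectrum (seq_space m) N \<subseteq> (\<lambda>x. \<chi> i. complex_of_real (vec_nth x i)) ` unit_cube"
  proof
    let ?A = "cstar_generated (seq_space m) (range (vec_nth N))"
    fix z assume "z \<in> joint_spectrum (seq_space m) N"
    then obtain f where f: "character_on (seq_space m) ?A f" and z: "z = (\<chi> i. f (vec_nth N i))"
      unfolding joint_spectrum_def by blast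
    have f_sgn: "f (vec_nth N i) = -1 \<or> f (vec_nth N i) = 1" for i
    proof -
      have "op_mult (seq_space m) (vec_nth N i) (vec_nth N i) = op_id (seq_space m)"
        unfolding N op_mult_mult_op sq by (simp add: mult_op_def op_id_def)
      moreover have "vec_nth N i \<in> ?A" using generator_in_cstar_generated by blast
      ultimately have "f (vec_nth N i) * f (vec_nth N i) = 1"
        using f unfolding character_on_def by metis
      then show ?thesis by (metis square_eq_1_iff)
    qed
    \<comment> \<open>The point of the cube is formed from real parts, which lose nothing as the
      character values are 1 or -1.\<close>
    have re: "of_real (Re (f (vec_nth N i))) = f (vec_nth N i)" "\<bar>Re (f (vec_nth N i))\<bar> \<le> 1" for i
      using f_sgn[of i] by auto
    show "z \<in> (\<lambda>x. \<chi> i. complex_of_real (vec_nth x i)) ` unit_cube"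
      by (rule image_eqI[of _ _ "\<chi> i. Re (f (vec_nth N i))"])
        (use re in \<open>auto simp: z unit_cube_def abs_le_iff\<close>)
  qed
  moreover have "isometry (Cn n) (seq_space m) (mat_op n m w)"
    using c unfolding sign_compression_def by (intro isometry_mat_op) blast
  moreover have "vec_nth X i *\<^sub>v u = adj (Cn n) (seq_space m) (mat_op n m w) (vec_nth N i (mat_op n m w u))"
    if "u \<in> carrier_vec n" for i u
    using c unfolding adj_mat_op N mat_op_adj_mult_op_mat_op[OF that] sign_compression_def by simp
  ultimately show ?thesis
    unfolding Wmin_def using X hilbert_space_seq_space by blast
qed


subsection \<open>Compressions as completely positive maps\<close>

lemma sum_nat_blocks:
  "(\<Sum>r<p * n. f r) = (\<Sum>i<p. \<Sum>a<n. f (i * n + a))" for f :: "nat \<Rightarrow> 'a::comm_monoid_add"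
proof -
  have "(\<Sum>r<p * n. f r) = (\<Sum>i<p. sum f {i * n..<i * n + n})"
    by (rule sum.nat_group[symmetric])
  also have "\<dots> = (\<Sum>i<p. \<Sum>a<n. f (i * n + a))"
  proof (rule sum.cong)
    fix i
    show "sum f {i * n..<i * n + n} = (\<Sum>a<n. f (i * n + a))"
      using sum.shift_bounds_nat_ivl[of f 0 "i * n" n] by (simp add: lessThan_atLeast0 add.commute)
  qed simp
  finally show ?thesis .
qed

text \<open>Writing indices as \<open>i * n + a\<close> splits the form into blocks, each pairing
  segment \<open>j\<close> of \<open>v\<close> with segment \<open>i\<close>.\<close>

lemma block_matrix_form:
  "(\<Sum>r<p * n. \<Sum>s<p * n. block_matrix p n A $$ (r, s) * v s * cnj (v r)) =
     (\<Sum>i<p. \<Sum>j<p. \<Sum>a<n. \<Sum>b<n. A i j $$ (a, b) * v (j * n + b) * cnj (v (i * n + a)))"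
proof -
  have less: "i * n + a < p * n" if "i < p" "a < n" for i a
  proof -
    have "i * n + a < Suc i * n" using that by simp
    also have "\<dots> \<le> p * n" using that by (intro mult_right_mono) auto
    finally show ?thesis .
  qed
  have "(\<Sum>r<p * n. \<Sum>s<p * n. block_matrix p n A $$ (r, s) * v s * cnj (v r)) =
     (\<Sum>i<p. \<Sum>a<n. \<Sum>j<p. \<Sum>b<n. A i j $$ (a, b) * v (j * n + b) * cnj (v (i * n + a)))"
    unfolding sum_nat_blocks
    by (intro sum.cong refl) (simp add: block_matrix_def less)
  also have "\<dots> = (\<Sum>i<p. \<Sum>j<p. \<Sum>a<n. \<Sum>b<n. A i j $$ (a, b) * v (j * n + b) * cnj (v (i * n + a)))"
    by (intro sum.cong refl sum.swap)
  finally show ?thesis .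
qed

definition compress :: "nat \<Rightarrow> nat \<Rightarrow> (nat \<Rightarrow> nat \<Rightarrow> complex) \<Rightarrow> complex mat \<Rightarrow> complex mat" where
  "compress m n w A = mat n n (\<lambda>(r, s). \<Sum>k<m. \<Sum>l<m. cnj (w k r) * A $$ (k, l) * w l s)"

text \<open>Moving the adjoint across the inner product replaces \<open>x\<close> and
  \<open>y\<close> by their images under \<open>w\<close>. Two different vectors are allowed because
  an off-diagonal block pairs different segments of a test vector.\<close>

lemma compress_form:
  "(\<Sum>a<n. \<Sum>b<n. compress m n w A $$ (a, b) * y b * cnj (x a)) =
     (\<Sum>k<m. \<Sum>l<m. A $$ (k, l) * (\<Sum>b<n. w l b * y b) * cnj (\<Sum>a<n. w k a * x a))"
proof -
  have "(\<Sum>a<n. \<Sum>b<n. compress m n w A $$ (a, b) * y b * cnj (x a)) =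
      (\<Sum>a<n. \<Sum>b<n. \<Sum>k<m. \<Sum>l<m. cnj (w k a) * A $$ (k, l) * w l b * y b * cnj (x a))"
    by (intro sum.cong refl) (simp add: compress_def sum_distrib_right)
  also have "\<dots> = (\<Sum>k<m. \<Sum>l<m. \<Sum>a<n. \<Sum>b<n. cnj (w k a) * A $$ (k, l) * w l b * y b * cnj (x a))"
  proof -
    define T where "T a b k l = cnj (w k a) * A $$ (k, l) * w l b * y b * cnj (x a)" for a b k l
    have "(\<Sum>a<n. \<Sum>b<n. \<Sum>k<m. \<Sum>l<m. T a b k l) = (\<Sum>a<n. \<Sum>k<m. \<Sum>b<n. \<Sum>l<m. T a b k l)"
      by (intro sum.cong refl sum.swap)
    also have "\<dots> = (\<Sum>k<m. \<Sum>a<n. \<Sum>b<n. \<Sum>l<m. T a b k l)"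
      by (rule sum.swap)
    also have "\<dots> = (\<Sum>k<m. \<Sum>a<n. \<Sum>l<m. \<Sum>b<n. T a b k l)"
      by (intro sum.cong refl sum.swap)
    also have "\<dots> = (\<Sum>k<m. \<Sum>l<m. \<Sum>a<n. \<Sum>b<n. T a b k l)"
      by (intro sum.cong refl sum.swap)
    finally show ?thesis unfolding T_def .
  qed
  also have "\<dots> = (\<Sum>k<m. \<Sum>l<m. A $$ (k, l) * (\<Sum>b<n. w l b * y b) * cnj (\<Sum>a<n. w k a * x a))"
  proof (intro sum.cong refl)
    fix k l
    show "(\<Sum>a<n. \<Sum>b<n. cnj (w k a) * A $$ (k, l) * w l b * y b * cnj (x a)) =
        A $$ (k, l) * (\<Sum>b<n. w l b * y b) * cnj (\<Sum>a<n. w k a * x a)"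
      unfolding cnj_sum sum_distrib_left sum_distrib_right
      by (simp add: algebra_simps)
  qed
  finally show ?thesis .
qed

lemma ucp_compress:
  assumes w: "\<And>r s. r < n \<Longrightarrow> s < n \<Longrightarrow> (\<Sum>k<m. cnj (w k r) * w k s) = (if r = s then 1 else 0)"
  shows "ucp m n (compress m n w)"
proof -
  have "linear_mat_map m n (compress m n w)"
    unfolding linear_mat_map_def
  proof (intro conjI ballI allI)
    fix A B :: "complex mat" and c :: complex
    assume A: "A \<in> carrier_mat m m"
    show "compress m n w A \<in> carrier_mat n n" by (simp add: compress_def)
    show "compress m n w (c \<cdot>\<^sub>m A) = c \<cdot>\<^sub>m compress m n w A"
      using A by (intro eq_matI) (auto simp: compress_def sum_distrib_left algebra_simps)
    assume B: "B \<in> carrier_mat m m"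
    show "compress m n w (A + B) = compress m n w A + compress m n w B"
      using A B by (intro eq_matI) (auto simp: compress_def sum.distrib algebra_simps)
  qed
  moreover have "psd (p * n) (block_matrix p n (\<lambda>i j. compress m n w (A i j)))"
    if "psd (p * m) (block_matrix p m A)" for p A
    unfolding psd_iff
  proof (intro conjI allI)
    fix v :: "nat \<Rightarrow> complex"
    \<comment> \<open>The image of \<open>v\<close> under the matrix \<open>w\<close> applied to
      each of the \<open>p\<close> segments: \<open>R div m\<close> is the segment and
      \<open>R mod m\<close> the position in it. The compressed block form at \<open>v\<close> is
      the original one at \<open>u\<close>.\<close>
    define u where "u R = (\<Sum>b<n. w (R mod m) b * v (R div m * n + b))" for R
    have "(\<Sum>r<p * n. \<Sum>s<p * n. block_matrix p n (\<lambda>i j. compress m n w (A i j)) $$ (r, s) * v s * cnj (v r)) =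
        (\<Sum>i<p. \<Sum>j<p. \<Sum>k<m. \<Sum>l<m. A i j $$ (k, l) *
          (\<Sum>b<n. w l b * v (j * n + b)) * cnj (\<Sum>a<n. w k a * v (i * n + a)))"
      unfolding block_matrix_form
      by (rule sum.cong[OF refl], rule sum.cong[OF refl], rule compress_form)
    also have "\<dots> = (\<Sum>i<p. \<Sum>j<p. \<Sum>k<m. \<Sum>l<m. A i j $$ (k, l) * u (j * m + l) * cnj (u (i * m + k)))"
      by (intro sum.cong refl) (simp add: u_def)
    also have "\<dots> = (\<Sum>r<p * m. \<Sum>s<p * m. block_matrix p m A $$ (r, s) * u s * cnj (u r))"
      by (rule block_matrix_form[symmetric])
    also have "0 \<le> \<dots>" using that unfolding psd_iff by blast
    finally show "0 \<le> (\<Sum>r<p * n. \<Sum>s<p * n.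
        block_matrix p n (\<lambda>i j. compress m n w (A i j)) $$ (r, s) * v s * cnj (v r))" .
  qed (simp add: block_matrix_def)
  moreover have "compress m n w (1\<^sub>m m) = 1\<^sub>m n"
  proof (rule eq_matI)
    fix r s assume "r < dim_row (1\<^sub>m n)" "s < dim_col (1\<^sub>m n)"
    then have rs: "r < n" "s < n" by simp_all
    have "(\<Sum>k<m. \<Sum>l<m. cnj (w k r) * 1\<^sub>m m $$ (k, l) * w l s) = (\<Sum>k<m. cnj (w k r) * w k s)"
    proof (intro sum.cong refl)
      fix k assume "k \<in> {..<m}"
      then have "(\<Sum>l<m. cnj (w k r) * 1\<^sub>m m $$ (k, l) * w l s) = (\<Sum>l<m. if l = k then cnj (w k r) * w k s else 0)"
        by (intro sum.cong) auto
      then show "(\<Sum>l<m. cnj (w k r) * 1\<^sub>m m $$ (k, l) * w l s) = cnj (w k r) * w k s"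
        using \<open>k \<in> {..<m}\<close> by simp
    qed
    then show "compress m n w (1\<^sub>m m) $$ (r, s) = 1\<^sub>m n $$ (r, s)"
      using rs w by (simp add: compress_def)
  qed (simp_all add: compress_def)
  ultimately show ?thesis unfolding ucp_def completely_positive_def by blast
qed

section \<open>Direct sums of points in a matrix convex set\<close>

definition diag_tuple :: "nat \<Rightarrow> (nat \<Rightarrow> real ^ 'd) \<Rightarrow> ('d::finite) mat_tuple" where
  "diag_tuple m \<sigma> = (\<chi> i. mat m m (\<lambda>(k, l). if k = l then of_real (vec_nth (\<sigma> k) i) else 0))"

text \<open>One scalar point is appended per step as a direct summand. The induction starts at size
  1, since the closure under direct sums concerns levels from 1 on.\<close>

lemma diag_tuple_in_matrix_convex:
  assumes S: "matrix_convex S" and \<sigma>: "\<And>k. scalar_tuple (\<sigma> k) \<in> S 1"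
  shows "diag_tuple (Suc m) \<sigma> \<in> S (Suc m)"
proof (induction m)
  case 0
  have "diag_tuple (Suc 0) \<sigma> = scalar_tuple (\<sigma> 0)"
    unfolding diag_tuple_def scalar_tuple_def Finite_Cartesian_Product.vec_eq_iff
    by (auto intro!: eq_matI)
  then show ?case using \<sigma> by simp
next
  case (Suc m)
  let ?D = "\<chi> i. direct_sum_mat (vec_nth (diag_tuple (Suc m) \<sigma>) i) (vec_nth (scalar_tuple (\<sigma> (Suc m))) i)"
  have "?D \<in> S (Suc m + 1)"
    using S Suc \<sigma> unfolding matrix_convex_def by (metis le_refl le_add1 plus_1_eq_Suc)
  moreover have "?D = diag_tuple (Suc (Suc m)) \<sigma>"
    unfolding diag_tuple_def scalar_tuple_def Finite_Cartesian_Product.vec_eq_iff direct_sum_mat_def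
    by (auto intro!: eq_matI simp: less_Suc_eq)
  ultimately show ?case by simp
qed

text \<open>The diagonal tuple lies in \<open>S m\<close> as a direct sum of cube vertices, and the
  UCP map \<open>compress m n w\<close> sends it to \<open>X\<close>: the diagonal collapses the
  double sum in \<open>compress\<close> to the single sum in
  \<open>sign_compression\<close>.\<close>

lemma sign_compression_in_matrix_convex:
  fixes X :: "('d::finite) mat_tuple"
  assumes c: "sign_compression n m \<sigma> w X" and n: "n \<ge> 1" and m: "m \<ge> 1"
    and S: "matrix_convex S" and cube: "scalar_tuple ` unit_cube \<subseteq> S 1"
  shows "X \<in> S n"
proof -
  have "\<sigma> k \<in> unit_cube" for k
  proof -
    have "\<sigma> k \<in> sign_vectors" using c unfolding sign_compression_def by blast
    then have "vec_nth (\<sigma> k) i = -1 \<or> vec_nth (\<sigma> k) i = 1" for i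
      unfolding sign_vectors_def by blast
    then have "vec_nth (\<sigma> k) i \<in> {-1..1}" for i
      by (metis atLeastAtMost_iff order_refl order_trans[of "-1" 0 "1::real"] neg_le_0_iff_le zero_le_one)
    then show ?thesis unfolding unit_cube_def by blast
  qed
  then have "scalar_tuple (\<sigma> k) \<in> S 1" for k using cube by blast
  then have D: "diag_tuple m \<sigma> \<in> S m"
    using diag_tuple_in_matrix_convex[OF S, of \<sigma> "m - 1"] m by simp
  have "ucp m n (compress m n w)"
    using c unfolding sign_compression_def by (intro ucp_compress) blast
  then have "(\<chi> i. compress m n w (vec_nth (diag_tuple m \<sigma>) i)) \<in> S n"
    using S D n m unfolding matrix_convex_def by blast
  moreover have "compress m n w (vec_nth (diag_tuple m \<sigma>) i) = vec_nth X i" for i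
  proof -
    have "compress m n w (vec_nth (diag_tuple m \<sigma>) i) =
        mat n n (\<lambda>(r, s). \<Sum>k<m. of_real (vec_nth (\<sigma> k) i) * cnj (w k r) * w k s)"
    proof (rule eq_matI)
      fix r s assume "r < dim_row (mat n n (\<lambda>(r, s). \<Sum>k<m. of_real (vec_nth (\<sigma> k) i) * cnj (w k r) * w k s))"
        "s < dim_col (mat n n (\<lambda>(r, s). \<Sum>k<m. of_real (vec_nth (\<sigma> k) i) * cnj (w k r) * w k s))"
      then have rs: "r < n" "s < n" by simp_all
      have "(\<Sum>l<m. cnj (w k r) * vec_nth (diag_tuple m \<sigma>) i $$ (k, l) * w l s) =
          of_real (vec_nth (\<sigma> k) i) * cnj (w k r) * w k s" if "k < m" for k
      proof -
        have "(\<Sum>l<m. cnj (w k r) * vec_nth (diag_tuple m \<sigma>) i $$ (k, l) * w l s) =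
            (\<Sum>l<m. if l = k then of_real (vec_nth (\<sigma> k) i) * cnj (w k r) * w k s else 0)"
          using that by (intro sum.cong) (auto simp: diag_tuple_def)
        then show ?thesis using that by simp
      qed
      then show "compress m n w (vec_nth (diag_tuple m \<sigma>) i) $$ (r, s) =
          mat n n (\<lambda>(r, s). \<Sum>k<m. of_real (vec_nth (\<sigma> k) i) * cnj (w k r) * w k s) $$ (r, s)"
        using rs by (simp add: compress_def)
    qed (simp_all add: compress_def)
    then show ?thesis using c unfolding sign_compression_def by simp
  qed
  ultimately show ?thesis by simp
qed


theorem corollary10p7:
  shows "(\<forall>n\<ge>1. Wmax (cross_polytope :: (real ^ 'd::finite) set) n \<subseteq> Wmin unit_cube n) \<and>
    (\<forall>S :: nat \<Rightarrow> 'd mat_tuple set. matrix_convex S \<longrightarrow> scalar_tuple ` unit_cube \<subseteq> S 1 \<longrightarrow>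
      (\<forall>n\<ge>1. Wmax cross_polytope n \<subseteq> S n))"
proof (intro conjI allI impI subsetI)
  fix n :: nat and X :: "'d mat_tuple"
  assume n: "n \<ge> 1" and X: "X \<in> Wmax cross_polytope n"
  then obtain m \<sigma> w where "sign_compression n m \<sigma> w X"
    using Wmax_cross_polytope_sign_compression by blast
  moreover have "X \<in> sa_tuples n" using X unfolding Wmax_def by blast
  ultimately show "X \<in> Wmin unit_cube n" by (intro sign_compression_in_Wmin)
next
  fix S :: "nat \<Rightarrow> 'd mat_tuple set" and n :: nat and X :: "'d mat_tuple"
  assume S: "matrix_convex S" "scalar_tuple ` unit_cube \<subseteq> S 1"
    and n: "n \<ge> 1" and X: "X \<in> Wmax cross_polytope n"
  from X n obtain m \<sigma> w where "m \<ge> 1" "sign_compression n m \<sigma> w X"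
    by (rule Wmax_cross_polytope_sign_compression)
  then show "X \<in> S n" using n S sign_compression_in_matrix_convex by blast
qed

end
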